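(* For every integer $t\ge 3$, there exists a pair of non $\epsilon$-cospectral $\epsilon$-equienergetic graphs on $6t+1$ vertices.
   Context: All graphs are finite, simple, undirected and connected. For a connected graph $G$ with distance function $d$, the eccentricity of a vertex $v$ is $e(v)=\max\{d(v,u):u\in V(G)\}$. The eccentricity matrix $\epsilon(G)$ is the symmetric matrix indexed by $V(G)$ with $(u,v)$ entry $d(u,v)$ if $d(u,v)=\min\{e(u),e(v)\}$, and $0$ otherwise. The $\epsilon$-spectrum of $G$ is the multiset of eigenvalues of $\epsilon(G)$, and the $\epsilon$-energy $E_\epsilon(G)$ is the sum of the absolute values of these eigenvalues (with multiplicity). Two non-isomorphic graphs of the same order are $\epsilon$-cospectral if they have the same $\epsilon$-spectrum, and non $\epsilon$-cospectral otherwise. Two graphs of the same order are $\epsilon$-equienergetic if they have the same $\epsilon$-energy. *)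

theory Defs
  imports "Graph_Theory.Graph_Theory" "Jordan_Normal_Form.Char_Poly" Complex_Main
begin

(* An undirected edge {u, v} is the pair of arcs (u, v), (v, u); pair_graph is the locale of
   finite, loop-free, symmetric digraphs. *)
definition connected_graph :: "'a pair_pre_digraph \<Rightarrow> bool" where
  "connected_graph G \<longleftrightarrow> pair_graph G \<and> Digraph_Component.connected (with_proj G)"

(* With unit weights the cost of a walk is its length. The infimum in wf_digraph.\<mu> is infinite only
   if there is no walk from u to v, which does not happen in a connected graph. *)
definition gdist :: "'a pair_pre_digraph \<Rightarrow> 'a \<Rightarrow> 'a \<Rightarrow> real" where
  "gdist G u v = real_of_ereal (wf_digraph.\<mu> (with_proj G) (\<lambda>_. 1) u v)"

definition eccentricity :: "'a pair_pre_digraph \<Rightarrow> 'a \<Rightarrow> real" where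
  "eccentricity G v = Max {gdist G v u | u. u \<in> pverts G}"

definition ecc_entry :: "'a pair_pre_digraph \<Rightarrow> 'a \<Rightarrow> 'a \<Rightarrow> real" where
  "ecc_entry G u v =
     (if gdist G u v = min (eccentricity G u) (eccentricity G v) then gdist G u v else 0)"

(* Matrices are indexed by {0..<n}, so the vertices are listed in increasing order; another
   order would conjugate the matrix by a permutation matrix, with the same spectrum. *)
definition ecc_matrix :: "'a::linorder pair_pre_digraph \<Rightarrow> real mat" where
  "ecc_matrix G =
     (let vs = sorted_list_of_set (pverts G); n = length vs
      in mat n n (\<lambda>(i, j). ecc_entry G (vs ! i) (vs ! j)))"

(* Eigenvalues are taken in the complex numbers, with algebraic multiplicity. They are real for a
   connected graph because the matrix is real and symmetric, so algebraic and geometric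
   multiplicities agree. *)
definition ecc_spectrum :: "'a::linorder pair_pre_digraph \<Rightarrow> complex multiset" where
  "ecc_spectrum G = proots (char_poly (map_mat complex_of_real (ecc_matrix G)))"

definition ecc_energy :: "'a::linorder pair_pre_digraph \<Rightarrow> real" where
  "ecc_energy G = (\<Sum>x\<in>#ecc_spectrum G. cmod x)"

definition same_order_nonisomorphic ::
    "'a pair_pre_digraph \<Rightarrow> 'b pair_pre_digraph \<Rightarrow> bool" where
  "same_order_nonisomorphic G H \<longleftrightarrow>
     card (pverts G) = card (pverts H) \<and> \<not> digraph_iso (with_proj G) (with_proj H)"

definition ecc_cospectral ::
    "'a::linorder pair_pre_digraph \<Rightarrow> 'b::linorder pair_pre_digraph \<Rightarrow> bool" where
  "ecc_cospectral G H \<longleftrightarrow> same_order_nonisomorphic G H \<and> ecc_spectrum G = ecc_spectrum H"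

(* "Non cospectral" is said of non-isomorphic graphs only, so it is not the plain negation. *)
definition non_ecc_cospectral ::
    "'a::linorder pair_pre_digraph \<Rightarrow> 'b::linorder pair_pre_digraph \<Rightarrow> bool" where
  "non_ecc_cospectral G H \<longleftrightarrow> same_order_nonisomorphic G H \<and> \<not> ecc_cospectral G H"

definition ecc_equienergetic ::
    "'a::linorder pair_pre_digraph \<Rightarrow> 'b::linorder pair_pre_digraph \<Rightarrow> bool" where
  "ecc_equienergetic G H \<longleftrightarrow> card (pverts G) = card (pverts H) \<and> ecc_energy G = ecc_energy H"

end

theory Submission
  imports Defs
begin

text \<open>
  In a complete bipartite graph with parts of sizes a, b \<ge> 2 every vertex has eccentricity 2, so the
  eccentricity matrix is block diagonal with blocks 2 (J - I). Its spectrum consists of 2 (a - 1),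
  2 (b - 1) and -2 with multiplicity a + b - 2, and the energy 4 (a + b - 2) depends on the order
  only. Hence any two such graphs of the same order with different parts will do, for instance
  those with parts of sizes (2, 6t - 1) and (3, 6t - 2).
\<close>

section \<open>Complete bipartite graphs and their arcs\<close>

text \<open>The parts are consecutive intervals of numbers, so that listing the vertices in
  increasing order makes the eccentricity matrix block diagonal without any permutation.\<close>

definition complete_bipartite :: "nat \<Rightarrow> nat \<Rightarrow> nat pair_pre_digraph" where
  "complete_bipartite a b = \<lparr> pverts = {..<a + b},
     parcs = {..<a} \<times> {a..<a + b} \<union> {a..<a + b} \<times> {..<a} \<rparr>"

lemma pverts_complete_bipartite [simp]: "pverts (complete_bipartite a b) = {..<a + b}"
  by (simp add: complete_bipartite_def)

lemma parcs_complete_bipartite [simp]: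
  "parcs (complete_bipartite a b) = {..<a} \<times> {a..<a + b} \<union> {a..<a + b} \<times> {..<a}"
  by (simp add: complete_bipartite_def)

lemma card_parcs_complete_bipartite: "card (parcs (complete_bipartite a b)) = 2 * a * b"
  by (subst parcs_complete_bipartite, subst card_Un_disjoint) auto

lemma pair_graph_complete_bipartite: "pair_graph (complete_bipartite a b)"
  by unfold_locales (auto simp: symmetric_def intro!: symI)

section \<open>Distances and connectedness\<close>

text \<open>With unit weights the infimum of the walk costs is attained at a shortest walk, so a
  distance can be certified by one walk and a lower bound on all others.\<close>

lemma (in pair_wf_digraph) gdist_eqI:
  assumes "awalk u p v" "\<And>q. awalk u q v \<Longrightarrow> length p \<le> length q"
  shows "gdist G u v = length p"
proof -
  have cost: "awalk_cost (\<lambda>_. 1) q = length q" for q :: "('a \<times> 'a) list"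
    by (induction q) auto
  have "\<mu> (\<lambda>_. 1) u v = ereal (length p)"
    unfolding \<mu>_def cost
  proof (rule antisym)
    show "(INF p\<in>{p. awalk u p v}. ereal (length p)) \<le> ereal (length p)"
      by (rule INF_lower2[of p]) (use assms in auto)
    show "ereal (length p) \<le> (INF p\<in>{p. awalk u p v}. ereal (length p))"
      by (rule INF_greatest) (use assms in auto)
  qed
  then show ?thesis by (simp add: gdist_def)
qed

lemma gdist_complete_bipartite:
  assumes "u < a + b" "v < a + b" "a > 0" "b > 0"
  shows "gdist (complete_bipartite a b) u v =
    (if u = v then 0 else if u < a \<longleftrightarrow> v < a then 2 else 1)"
proof -
  interpret pair_graph "complete_bipartite a b"
    by (rule pair_graph_complete_bipartite)
  consider "u = v" | "u \<noteq> v" "u < a \<longleftrightarrow> v < a" | "u \<noteq> v" "\<not> (u < a \<longleftrightarrow> v < a)"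
    by blast
  then show ?thesis
  proof cases
    case 1
    then show ?thesis
      using gdist_eqI[of u "[]" v] assms by (auto simp: awalk_Nil_iff)
  next
    case 2
    \<comment> \<open>\<open>w\<close> lies in the part opposite to \<open>u\<close> and
      \<open>v\<close>, hence is a common neighbour.\<close>
    define w where "w = (if u < a then a else 0)"
    have "gdist (complete_bipartite a b) u v = length [(u, w), (w, v)]"
    proof (rule gdist_eqI)
      show "awalk u [(u, w), (w, v)] v"
        using 2 assms by (auto simp: awalk_Cons_iff awalk_Nil_iff w_def)
      show "length [(u, w), (w, v)] \<le> length q" if "awalk u q v" for q
        \<comment> \<open>The empty walk would give \<open>u = v\<close>, and a single arc would
          join two vertices of the same part.\<close>
        using that 2
        by (cases q; cases "tl q") (auto simp: awalk_Cons_iff awalk_Nil_iff)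
    qed
    with 2 show ?thesis by simp
  next
    case 3
    have "gdist (complete_bipartite a b) u v = length [(u, v)]"
    proof (rule gdist_eqI)
      show "awalk u [(u, v)] v"
        using 3 assms by (auto simp: awalk_Cons_iff awalk_Nil_iff)
      show "length [(u, v)] \<le> length q" if "awalk u q v" for q
        using that 3 by (cases q) (auto simp: awalk_Nil_iff)
    qed
    with 3 show ?thesis by simp
  qed
qed

lemma connected_graph_complete_bipartite:
  assumes "a > 0" "b > 0"
  shows "connected_graph (complete_bipartite a b)"
proof -
  interpret pair_graph "complete_bipartite a b"
    by (rule pair_graph_complete_bipartite)
  have adj: "u \<rightarrow>\<^sup>*\<^bsub>with_proj (complete_bipartite a b)\<^esub> v"
    if "u < a + b" "v < a + b" "\<not> (u < a \<longleftrightarrow> v < a)" for u v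
    by (rule reachable_adjI) (use that in auto)
  have reach: "u \<rightarrow>\<^sup>*\<^bsub>with_proj (complete_bipartite a b)\<^esub> v"
    if "u < a + b" "v < a + b" for u v
  proof (cases "u < a \<longleftrightarrow> v < a")
    case True
    show ?thesis
      by (rule reachable_trans[OF adj[of u "if u < a then a else 0"] adj])
        (use assms that True in auto)
  qed (use adj that in blast)
  have "Digraph_Component.connected (with_proj (complete_bipartite a b))"
    unfolding Digraph_Component.connected_def
    by (rule strongly_connectedI) (use assms reach in \<open>auto intro: reachable_mk_symmetricI\<close>)
  then show ?thesis
    by (simp add: connected_graph_def pair_graph_complete_bipartite)
qed

section \<open>Eccentricities and the eccentricity matrix\<close>

text \<open>Since each part has at least two vertices, \<open>v\<close> has a companion in its own
  part, at the maximal distance 2.\<close>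

lemma eccentricity_complete_bipartite:
  assumes "v < a + b" "a \<ge> 2" "b \<ge> 2"
  shows "eccentricity (complete_bipartite a b) v = 2"
  unfolding eccentricity_def
proof (rule Max_eqI)
  have "\<exists>u<a + b. u \<noteq> v \<and> (u < a \<longleftrightarrow> v < a)"
  proof (cases "v < a")
    case True
    then show ?thesis
      using assms by (intro exI[of _ "if v = 0 then 1 else 0"]) auto
  next
    case False
    then show ?thesis
      using assms by (intro exI[of _ "if v = a then a + 1 else a"]) auto
  qed
  then obtain u where "u < a + b" "u \<noteq> v" "u < a \<longleftrightarrow> v < a" by blast
  then show "2 \<in> {gdist (complete_bipartite a b) v u |u. u \<in> pverts (complete_bipartite a b)}"
    using assms by (auto intro!: exI[of _ u] simp: gdist_complete_bipartite)
qed (use assms in \<open>auto simp: gdist_complete_bipartite\<close>)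

text \<open>All eccentricities are 2, so the distances 1 between the parts are replaced by 0 and
  only the distances 2 inside a part survive.\<close>

lemma ecc_matrix_complete_bipartite:
  assumes "a \<ge> 2" "b \<ge> 2"
  shows "ecc_matrix (complete_bipartite a b) =
    mat (a + b) (a + b) (\<lambda>(i, j). if i \<noteq> j \<and> (i < a \<longleftrightarrow> j < a) then 2 else 0)"
proof -
  have vs: "sorted_list_of_set {..<a + b} = [0..<a + b]"
    by (simp add: lessThan_atLeast0 del: upt_Suc)
  show ?thesis
    unfolding ecc_matrix_def pverts_complete_bipartite vs Let_def length_upt minus_nat.diff_0
    by (rule eq_matI) (use assms in \<open>auto simp: ecc_entry_def gdist_complete_bipartite
        eccentricity_complete_bipartite simp del: upt_Suc\<close>)
qed

section \<open>Characteristic polynomials of the blocks\<close>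

lemma char_poly_const_diag_const_offdiag:
  fixes \<alpha> \<beta> :: "'a :: comm_ring_1"
  shows "char_poly (mat (Suc m) (Suc m) (\<lambda>(i, j). if i = j then \<alpha> else \<beta>)) =
    [:- (\<alpha> + of_nat m * \<beta>), 1:] * [:- (\<alpha> - \<beta>), 1:] ^ m"
proof -
  (* Subtracting row 0 from all others and adding all columns to column 0 conjugates A into the
     upper triangular B. *)
  define n where "n = Suc m"
  define A where "A = mat n n (\<lambda>(i, j). if i = j then \<alpha> else \<beta>)"
  define B where "B = mat n n (\<lambda>(i, j).
    if i = 0 then if j = 0 then \<alpha> + of_nat m * \<beta> else \<beta> else if i = j then \<alpha> - \<beta> else 0)"
  define P :: "'a mat" where "P = mat n n (\<lambda>(i, j). if i = j \<or> j = 0 then 1 else 0)"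
  define Q :: "'a mat"
    where "Q = mat n n (\<lambda>(i, j). if i = j then 1 else if j = 0 then -1 else 0)"
  note defs = A_def B_def P_def Q_def
  have carrier: "A \<in> carrier_mat n n" "B \<in> carrier_mat n n" "P \<in> carrier_mat n n"
    "Q \<in> carrier_mat n n"
    by (simp_all add: defs)
  have row_sum: "(\<Sum>k\<in>{0..<n}. if i = k then \<alpha> else \<beta>) = \<alpha> + of_nat m * \<beta>" if "i < n" for i
  proof -
    have "(\<Sum>k\<in>{0..<n}. if i = k then \<alpha> else \<beta>) = (\<Sum>k\<in>{0..<n}. \<beta> + (if i = k then \<alpha> - \<beta> else 0))"
      by (intro sum.cong) auto
    also have "\<dots> = of_nat n * \<beta> + (\<alpha> - \<beta>)"
      using that by (subst sum.distrib) simp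
    finally show ?thesis
      by (simp add: n_def algebra_simps)
  qed
  have PX: "(P * X) $$ (i, j) = (if i = 0 then X $$ (0, j) else X $$ (0, j) + X $$ (i, j))"
    if "X \<in> carrier_mat n n" "i < n" "j < n" for X i j
  proof -
    have "(P * X) $$ (i, j) = (\<Sum>k\<in>{0..<n}. P $$ (i, k) * X $$ (k, j))"
      using that carrier by (auto simp: scalar_prod_def)
    \<comment> \<open>Only \<open>k = 0\<close> and \<open>k = i\<close> contribute; the inner test
      on \<open>i\<close> avoids counting the term twice when they coincide.\<close>
    also have "\<dots> = (\<Sum>k\<in>{0..<n}. (if k = 0 then X $$ (0, j) else 0) +
        (if k = i then if i = 0 then 0 else X $$ (i, j) else 0))"
      using that by (intro sum.cong) (auto simp: P_def)
    also have "\<dots> = (if i = 0 then X $$ (0, j) else X $$ (0, j) + X $$ (i, j))"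
      using that by (subst sum.distrib) auto
    finally show ?thesis .
  qed
  have QX: "(Q * X) $$ (i, j) = (if i = 0 then X $$ (0, j) else X $$ (i, j) - X $$ (0, j))"
    if "X \<in> carrier_mat n n" "i < n" "j < n" for X i j
  proof -
    have "(Q * X) $$ (i, j) = (\<Sum>k\<in>{0..<n}. Q $$ (i, k) * X $$ (k, j))"
      using that carrier by (auto simp: scalar_prod_def)
    also have "\<dots> = (\<Sum>k\<in>{0..<n}. (if k = 0 then if i = 0 then 0 else - X $$ (0, j) else 0) +
        (if k = i then X $$ (i, j) else 0))"
      using that by (intro sum.cong) (auto simp: Q_def)
    also have "\<dots> = (if i = 0 then X $$ (0, j) else X $$ (i, j) - X $$ (0, j))"
      using that by (subst sum.distrib) auto
    finally show ?thesis .
  qed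
  have PQ: "P * Q = 1\<^sub>m n" and QP: "Q * P = 1\<^sub>m n"
    by (rule eq_matI;
        use carrier in \<open>auto simp: PX QX simp del: index_mult_mat(1)\<close>;
        auto simp: P_def Q_def)+
  have AP: "(A * P) $$ (i, j) = (if j = 0 then \<alpha> + of_nat m * \<beta> else A $$ (i, j))"
    if "i < n" "j < n" for i j
  proof -
    have "(A * P) $$ (i, j) = (\<Sum>k\<in>{0..<n}. A $$ (i, k) * P $$ (k, j))"
      using that carrier by (auto simp: scalar_prod_def)
    also have "\<dots> = (\<Sum>k\<in>{0..<n}. if j = 0 then if i = k then \<alpha> else \<beta> else
        if k = j then A $$ (i, j) else 0)"
      using that by (intro sum.cong) (auto simp: P_def A_def)
    also have "\<dots> = (if j = 0 then \<alpha> + of_nat m * \<beta> else A $$ (i, j))"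
      using that row_sum[of i] by auto
    finally show ?thesis .
  qed
  \<comment> \<open>Both sides are covered by the entry formulas \<open>AP\<close> and
    \<open>PX\<close>, so no triple product has to be expanded.\<close>
  have "A * P = P * B"
    by (rule eq_matI;
        use carrier in \<open>auto simp: PX AP simp del: index_mult_mat(1)\<close>;
        auto simp: A_def B_def)
  then have "A = P * B * Q"
    using carrier PQ by (metis assoc_mult_mat right_mult_one_mat)
  with carrier PQ QP have "similar_mat A B"
    by (intro similar_matI[of A B P Q n]) auto
  then have "char_poly A = char_poly B"
    by (rule char_poly_similar)
  also have "\<dots> = (\<Prod>c\<leftarrow>diag_mat B. [:- c, 1:])"
    by (rule char_poly_upper_triangular[OF carrier(2)]) (auto simp: B_def upper_triangular_def)
  also have "diag_mat B = (\<alpha> + of_nat m * \<beta>) # replicate m (\<alpha> - \<beta>)"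
    by (rule nth_equalityI) (auto simp: diag_mat_def B_def n_def nth_Cons' simp del: upt_Suc)
  finally show ?thesis
    by (simp add: A_def n_def)
qed

text \<open>The matrix \<open>char_poly_matrix\<close> inherits the block form, and the determinant
  of a block triangular matrix is the product of those of its diagonal blocks.\<close>

lemma char_poly_four_block_diag:
  fixes A B :: "'a :: idom mat"
  assumes A: "A \<in> carrier_mat n n" and B: "B \<in> carrier_mat m m"
  shows "char_poly (four_block_mat A (0\<^sub>m n m) (0\<^sub>m m n) B) = char_poly A * char_poly B"
proof -
  have "char_poly_matrix (four_block_mat A (0\<^sub>m n m) (0\<^sub>m m n) B) =
      four_block_mat (char_poly_matrix A) (0\<^sub>m n m) (0\<^sub>m m n) (char_poly_matrix B)"
    by (rule eq_matI) (use A B in \<open>auto simp: char_poly_matrix_def one_poly_def\<close>)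
  then show ?thesis
    unfolding char_poly_def
    by (simp add: det_four_block_mat_lower_left_zero[OF _ _ refl] A B)
qed

section \<open>Spectrum and energy\<close>

lemma ecc_spectrum_complete_bipartite:
  assumes "a \<ge> 2" "b \<ge> 2"
  shows "ecc_spectrum (complete_bipartite a b) =
     {#of_nat (2 * (a - 1)), of_nat (2 * (b - 1))#} + replicate_mset (a + b - 2) (- 2)"
proof -
  obtain k l where ab: "a = Suc k" "b = Suc l"
    using assms by (metis Suc_le_D numeral_2_eq_2)
  \<comment> \<open>\<open>?M m\<close> is the block 2 (J - I) of size m + 1; taking \<alpha> = 0
    and \<beta> = 2 above gives the eigenvalue 2 m once and -2 with multiplicity m.\<close>
  let ?M = "\<lambda>m. mat (Suc m) (Suc m) (\<lambda>(i, j). if i = j then 0 else 2 :: complex)"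
  let ?p = "\<lambda>m. [:- of_nat (2 * m), 1:] * [:2, 1:] ^ m :: complex poly"
  have p: "char_poly (?M m) = ?p m" for m
    by (subst char_poly_const_diag_const_offdiag) (simp add: mult.commute)
  have "map_mat complex_of_real (ecc_matrix (complete_bipartite a b)) =
      four_block_mat (?M k) (0\<^sub>m a b) (0\<^sub>m b a) (?M l)"
    by (subst ecc_matrix_complete_bipartite[OF assms]) (auto simp: ab intro!: eq_matI)
  then have char_poly: "char_poly (map_mat complex_of_real (ecc_matrix (complete_bipartite a b))) =
      ?p k * ?p l"
    unfolding ab by (simp only: char_poly_four_block_diag[OF mat_carrier mat_carrier] p)
  have proots: "proots (?p m) = {#of_nat (2 * m)#} + replicate_mset m (-2)" for m
    by (subst proots_mult) (auto simp: proots_power simp del: of_nat_mult)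
  have "proots (?p k * ?p l) = proots (?p k) + proots (?p l)"
    by (rule proots_mult; intro no_zero_divisors power_not_zero) auto
  also have "\<dots> = {#of_nat (2 * k), of_nat (2 * l)#} + replicate_mset (k + l) (-2)"
    unfolding proots by (simp add: multiset_eq_iff)
  finally show ?thesis
    unfolding ecc_spectrum_def char_poly by (simp add: ab)
qed

text \<open>The two positive eigenvalues sum to 2 (a + b - 2), and the a + b - 2 eigenvalues -2
  contribute the same amount in absolute value.\<close>

lemma ecc_energy_complete_bipartite:
  assumes "a \<ge> 2" "b \<ge> 2"
  shows "ecc_energy (complete_bipartite a b) = 4 * (a + b - 2)"
proof -
  have "a - 1 + (b - 1) = a + b - 2"
    using assms by simp
  then have "real (2 * (a - 1)) + real (2 * (b - 1)) = 2 * real (a + b - 2)"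
    by (metis distrib_left of_nat_add of_nat_mult of_nat_numeral)
  then show ?thesis
    unfolding ecc_energy_def ecc_spectrum_complete_bipartite[OF assms]
    by (simp del: of_nat_mult of_nat_diff add: norm_of_nat)
qed

section \<open>The pair of graphs\<close>

text \<open>An isomorphism is injective on arcs. The number of arcs is the invariant that separates
  the two graphs below.\<close>

lemma digraph_iso_card_arcs:
  assumes "digraph_iso G H"
  shows "card (arcs G) = card (arcs H)"
  using assms
  by (auto simp: digraph_iso_def pre_digraph.digraph_isomorphism_def card_image)

theorem theorem5p3:
  fixes t :: nat
  assumes "t \<ge> 3"
  shows "\<exists>(G :: nat pair_pre_digraph) (H :: nat pair_pre_digraph).
           connected_graph G \<and> connected_graph H \<and>
           card (pverts G) = 6 * t + 1 \<and> card (pverts H) = 6 * t + 1 \<and>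
           non_ecc_cospectral G H \<and> ecc_equienergetic G H"
proof -
  let ?G = "complete_bipartite 2 (6 * t - 1)" and ?H = "complete_bipartite 3 (6 * t - 2)"
  have "\<not> digraph_iso (with_proj ?G) (with_proj ?H)"
  proof
    assume "digraph_iso (with_proj ?G) (with_proj ?H)"
    from digraph_iso_card_arcs[OF this]
    \<comment> \<open>This amounts to 24 t - 4 = 36 t - 12, that is 12 t = 8, which no natural
      number satisfies.\<close>
    have "2 * 2 * (6 * t - 1) = 2 * 3 * (6 * t - 2)"
      by (simp only: with_proj_simps card_parcs_complete_bipartite)
    with assms show False by simp
  qed
  moreover have "ecc_spectrum ?G \<noteq> ecc_spectrum ?H"
  proof
    assume eq: "ecc_spectrum ?G = ecc_spectrum ?H"
    \<comment> \<open>The part of size 2 yields the eigenvalue 2 (2 - 1) = 2, whereas the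
      eigenvalues of \<open>?H\<close> are 4, 2 (6 t - 3) and -2.\<close>
    have "of_nat 2 \<in># ecc_spectrum ?G"
      using assms by (subst ecc_spectrum_complete_bipartite) auto
    then have "of_nat 2 \<in># {#of_nat (2 * (3 - 1)), of_nat (2 * (6 * t - 2 - 1))#} +
        replicate_mset (3 + (6 * t - 2) - 2) (- 2 :: complex)"
      using assms unfolding eq by (subst (asm) ecc_spectrum_complete_bipartite) auto
    then have "(2 :: nat) = 2 * (3 - 1) \<or> (2 :: nat) = 2 * (6 * t - 2 - 1) \<or> (2 :: complex) = - 2"
      by (simp only: union_iff in_replicate_mset set_mset_add_mset_insert insert_iff of_nat_eq_iff
          set_mset_empty empty_iff of_nat_numeral) auto
    with assms show False by auto
  qed
  moreover have "ecc_energy ?G = ecc_energy ?H"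
    using assms by (simp add: ecc_energy_complete_bipartite)
  moreover have "connected_graph ?G" "connected_graph ?H"
    using assms by (simp_all add: connected_graph_complete_bipartite)
  moreover have "card (pverts ?G) = 6 * t + 1" "card (pverts ?H) = 6 * t + 1"
    using assms by simp_all
  ultimately show ?thesis
    unfolding non_ecc_cospectral_def ecc_cospectral_def same_order_nonisomorphic_def
      ecc_equienergetic_def
    by (intro exI[of _ ?G] exI[of _ ?H]) simp
qed

end
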